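(* Let $p\ge5$ and $d\ge2$ be integers, $n_1,\dots,n_{d-1}\ge1$ integers, and $v_x,v_y>0$ known variances. Let $\boldsymbol{X}\mid\boldsymbol{\theta}\sim N_p(\boldsymbol{\theta},v_xI_p)$ and $\boldsymbol{Y}\mid\boldsymbol{\theta}\sim N_p(\boldsymbol{\theta},v_yI_p)$ be independent given the common unknown mean $\boldsymbol{\theta}\in\mathbb{R}^p$. Let $\pi$ be the prior on $\boldsymbol{\theta}$ induced by the depth-$d$ ReLU Bayesian neural network with a $\mathrm{BetaPrime}(1,\tfrac p2-2)$ hyperprior on its effective output variance (defined in the context). Then the Bayes predictive density $$\hat p_\pi(\boldsymbol{y}\mid\boldsymbol{x})=\frac{\int p(\boldsymbol{x}\mid\boldsymbol{\theta})\,p(\boldsymbol{y}\mid\boldsymbol{\theta})\,\pi(\boldsymbol{\theta})\,d\boldsymbol{\theta}}{\int p(\boldsymbol{x}\mid\boldsymbol{\theta})\,\pi(\boldsymbol{\theta})\,d\boldsymbol{\theta}}$$ is admissible under Kullback--Leibler risk with respect to the set of all proper densities on $\mathbb{R}^p$, $$A_0=\Big\{g:\mathbb{R}^p\to\mathbb{R}\ :\ g(\boldsymbol{y})\ge0\ \text{and}\ \int g(\boldsymbol{y})\,d\boldsymbol{y}=1\Big\}.$$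
   Context: Here $p(\boldsymbol{x}\mid\boldsymbol{\theta})$ and $p(\boldsymbol{y}\mid\boldsymbol{\theta})$ are the $N_p(\boldsymbol{\theta},v_xI_p)$ and $N_p(\boldsymbol{\theta},v_yI_p)$ densities. A predictive rule assigns to each $\boldsymbol{x}$ a density $\hat p(\cdot\mid\boldsymbol{x})\in A_0$. Its loss is $L(\boldsymbol{\theta},\hat p(\cdot\mid\boldsymbol{x}))=\int p(\boldsymbol{y}\mid\boldsymbol{\theta})\log\frac{p(\boldsymbol{y}\mid\boldsymbol{\theta})}{\hat p(\boldsymbol{y}\mid\boldsymbol{x})}\,d\boldsymbol{y}$ and its risk is $R_{KL}(\boldsymbol{\theta},\hat p)=\int p(\boldsymbol{x}\mid\boldsymbol{\theta})L(\boldsymbol{\theta},\hat p(\cdot\mid\boldsymbol{x}))\,d\boldsymbol{x}$. The rule $\hat p$ is admissible (with respect to $A_0$) if there is no predictive rule $\tilde p$ with values in $A_0$ such that $R_{KL}(\boldsymbol{\theta},\tilde p)\le R_{KL}(\boldsymbol{\theta},\hat p)$ for all $\boldsymbol{\theta}\in\mathbb{R}^p$ with strict inequality for at least one $\boldsymbol{\theta}$. Prior $\pi$: the index $\boldsymbol{k}=(k_1,\dots,k_{d-1})$, $1\le k_\ell\le n_\ell$, has weight $\omega_{\boldsymbol{k}}=2^{-(n_1+\dots+n_{d-1})}\prod_{\ell=1}^{d-1}\binom{n_\ell}{k_\ell}$ (finite total mass, not one, since the atom at the zero output is discarded; normalization does not affect $\hat p_\pi$). Given $\boldsymbol{k}$,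 $T_\ell\sim\Gamma(k_\ell/2,1)$ are independent and $S=\prod_{\ell=1}^{d-1}T_\ell$. With $U=2^{d-1}\|\boldsymbol{x}_0\|^2\prod_{\ell=1}^d\sigma_\ell^2$ the (now random) scale factor of the network, where $\boldsymbol{x}_0$ is the fixed network input and $\sigma_\ell$ the layer scales, $\boldsymbol{\theta}\mid U,S,\boldsymbol{k}\sim N_p(\boldsymbol{0}_p,US\,I_p)$. The hyperprior on $U$ is such that, conditionally on $(S,\boldsymbol{k})$, the effective output variance $W=US$ has the $\mathrm{BetaPrime}(1,b)$ density $h(w)=b(1+w)^{-(b+1)}$, $w>0$, $b=\tfrac p2-2$. $\pi(\boldsymbol{\theta})$ is the resulting marginal prior density of $\boldsymbol{\theta}$. *)

theory Defs
  imports "HOL-Probability.Probability"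
begin

section \<open>Gaussian model and predictive rules\<close>

definition gauss_density :: "real ^ 'p \<Rightarrow> real \<Rightarrow> real ^ 'p \<Rightarrow> real" where
  "gauss_density \<mu> v x =
     (2 * pi * v) powr (- (real CARD('p) / 2)) * exp (- (norm (x - \<mu>))\<^sup>2 / (2 * v))"

definition proper_densities :: "(real ^ 'p \<Rightarrow> real) set" where
  "proper_densities =
     {g. (\<forall>y. 0 \<le> g y) \<and> integrable lborel g \<and> (\<integral>y. g y \<partial>lborel) = 1}"

text \<open>Joint measurability is what makes the risk of a rule meaningful.\<close>

definition predictive_rule ::
  "(real ^ 'p \<Rightarrow> real) set \<Rightarrow> (real ^ 'p \<Rightarrow> real ^ 'p \<Rightarrow> real) \<Rightarrow> bool" where
  "predictive_rule A q \<longleftrightarrow>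
     (\<lambda>(x, y). q x y) \<in> borel_measurable (borel \<Otimes>\<^sub>M borel) \<and> (\<forall>x. q x \<in> A)"

section \<open>Kullback--Leibler loss and risk\<close>

text \<open>
  Loss and risk may be infinite, so they are extended-real integrals, positive part minus
  negative part.  The indeterminate case does not arise for the loss of a proper density:
  by \<open>a * ln (a / c) \<ge> a - c\<close> the negative part of the integrand has integral at most one.
  The loss is nonnegative, so it does not arise for the risk either.
\<close>

definition ext_integral :: "'a measure \<Rightarrow> ('a \<Rightarrow> ereal) \<Rightarrow> ereal" where
  "ext_integral M f =
     enn2ereal (\<integral>\<^sup>+ x. e2ennreal (f x) \<partial>M) - enn2ereal (\<integral>\<^sup>+ x. e2ennreal (- f x) \<partial>M)"

text \<open>
  \<open>log (a / c)\<close> for \<open>a > 0\<close> and \<open>c \<ge> 0\<close>.  The case \<open>c = 0\<close> has to be separated, because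
  \<open>ln (a / 0)\<close> is \<open>0\<close> in HOL rather than infinite.
\<close>

definition log_ratio :: "real \<Rightarrow> real \<Rightarrow> ereal" where
  "log_ratio a c = (if c = 0 then \<infinity> else ereal (ln (a / c)))"

definition KL_loss :: "real \<Rightarrow> real ^ 'p \<Rightarrow> (real ^ 'p \<Rightarrow> real) \<Rightarrow> ereal" where
  "KL_loss vy \<theta> g =
     ext_integral lborel
       (\<lambda>y. ereal (gauss_density \<theta> vy y) * log_ratio (gauss_density \<theta> vy y) (g y))"

definition KL_risk ::
  "real \<Rightarrow> real \<Rightarrow> real ^ 'p \<Rightarrow> (real ^ 'p \<Rightarrow> real ^ 'p \<Rightarrow> real) \<Rightarrow> ereal" where
  "KL_risk vx vy \<theta> q =
     ext_integral lborel (\<lambda>x. ereal (gauss_density \<theta> vx x) * KL_loss vy \<theta> (q x))"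

definition KL_admissible ::
  "real \<Rightarrow> real \<Rightarrow> (real ^ 'p \<Rightarrow> real) set \<Rightarrow> (real ^ 'p \<Rightarrow> real ^ 'p \<Rightarrow> real) \<Rightarrow> bool" where
  "KL_admissible vx vy A q \<longleftrightarrow>
     predictive_rule A q \<and>
     \<not> (\<exists>q'. predictive_rule A q' \<and>
             (\<forall>\<theta>. KL_risk vx vy \<theta> q' \<le> KL_risk vx vy \<theta> q) \<and>
             (\<exists>\<theta>. KL_risk vx vy \<theta> q' < KL_risk vx vy \<theta> q))"

section \<open>The prior induced by the ReLU network\<close>

definition unit_indices :: "nat \<Rightarrow> (nat \<Rightarrow> nat) \<Rightarrow> (nat \<Rightarrow> nat) set" where
  "unit_indices d n = (\<Pi>\<^sub>E l\<in>{1..d - 1}. {1..n l})"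

definition unit_weight :: "nat \<Rightarrow> (nat \<Rightarrow> nat) \<Rightarrow> (nat \<Rightarrow> nat) \<Rightarrow> real" where
  "unit_weight d n k =
     (\<Prod>l\<in>{1..d - 1}. real (n l choose k l)) / 2 ^ (\<Sum>l\<in>{1..d - 1}. n l)"

text \<open>The density of \<open>\<Gamma>(a, 1)\<close>.\<close>

definition gamma_density :: "real \<Rightarrow> real \<Rightarrow> real" where
  "gamma_density a t = (if 0 < t then t powr (a - 1) * exp (- t) / Gamma a else 0)"

text \<open>The law of \<open>S\<close>, the product of the independent \<open>T\<^sub>l \<sim> \<Gamma>(k\<^sub>l / 2, 1)\<close>, given \<open>k\<close>.\<close>

definition S_law :: "nat \<Rightarrow> (nat \<Rightarrow> nat) \<Rightarrow> real measure" where
  "S_law d k =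
     distr (\<Pi>\<^sub>M l\<in>{1..d - 1}. density lborel (\<lambda>t. ennreal (gamma_density (real (k l) / 2) t)))
           borel (\<lambda>t. \<Prod>l\<in>{1..d - 1}. t l)"

text \<open>The random variable \<open>U\<close>, as a function of the layer scales \<open>\<sigma> 1, \<dots>, \<sigma> d\<close>.\<close>

definition scale_factor :: "nat \<Rightarrow> real ^ 'm \<Rightarrow> (nat \<Rightarrow> real) \<Rightarrow> real" where
  "scale_factor d x0 \<sigma> = 2 ^ (d - 1) * (norm x0)\<^sup>2 * (\<Prod>l\<in>{1..d}. (\<sigma> l)\<^sup>2)"

text \<open>The density of \<open>BetaPrime(1, b)\<close>.\<close>

definition beta_prime_density :: "real \<Rightarrow> real \<Rightarrow> real" where
  "beta_prime_density b w = (if 0 < w then b * (1 + w) powr (- (b + 1)) else 0)"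

text \<open>
  \<open>H k s\<close> is the conditional law of the layer scales given \<open>k\<close> and \<open>S = s\<close>; the hyperprior
  on \<open>U\<close> is its image under \<open>scale_factor d x0\<close>, and every conditional law of \<open>U\<close> on the
  positive reals arises in this way when \<open>x0 \<noteq> 0\<close>.  The condition says that \<open>W = U * S\<close> has
  the \<open>BetaPrime(1, b)\<close> density conditionally on \<open>(S, k)\<close>.  Since \<open>S > 0\<close> almost surely,
  nothing is required of \<open>H k s\<close> for \<open>s \<le> 0\<close>.
\<close>

definition beta_prime_hyperprior ::
  "nat \<Rightarrow> (nat \<Rightarrow> nat) \<Rightarrow> real ^ 'm \<Rightarrow> real
    \<Rightarrow> ((nat \<Rightarrow> nat) \<Rightarrow> real \<Rightarrow> (nat \<Rightarrow> real) measure) \<Rightarrow> bool" where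
  "beta_prime_hyperprior d n x0 b H \<longleftrightarrow>
     (\<forall>k\<in>unit_indices d n. \<forall>s>0.
        sets (H k s) = sets (\<Pi>\<^sub>M l\<in>{1..d}. (borel :: real measure)) \<and>
        distr (H k s) borel (\<lambda>\<sigma>. scale_factor d x0 \<sigma> * s) =
          density lborel (\<lambda>w. ennreal (beta_prime_density b w)))"

text \<open>
  The marginal prior density of \<open>\<theta>\<close>.  It is extended-valued because it can have a pole at
  \<open>\<theta> = 0\<close>.
\<close>

definition bnn_prior ::
  "nat \<Rightarrow> (nat \<Rightarrow> nat) \<Rightarrow> real ^ 'm \<Rightarrow> ((nat \<Rightarrow> nat) \<Rightarrow> real \<Rightarrow> (nat \<Rightarrow> real) measure)
    \<Rightarrow> real ^ 'p \<Rightarrow> ennreal" where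
  "bnn_prior d n x0 H \<theta> =
     (\<Sum>k\<in>unit_indices d n. ennreal (unit_weight d n k) *
        (\<integral>\<^sup>+ s. (\<integral>\<^sup>+ \<sigma>. ennreal (gauss_density 0 (scale_factor d x0 \<sigma> * s) \<theta>) \<partial>H k s)
           \<partial>S_law d k))"

section \<open>The Bayes predictive density\<close>

definition bayes_predictive ::
  "real \<Rightarrow> real \<Rightarrow> (real ^ 'p \<Rightarrow> ennreal) \<Rightarrow> real ^ 'p \<Rightarrow> real ^ 'p \<Rightarrow> real" where
  "bayes_predictive vx vy \<pi> x y =
     enn2real
       ((\<integral>\<^sup>+ \<theta>. ennreal (gauss_density \<theta> vx x) * ennreal (gauss_density \<theta> vy y) * \<pi> \<theta> \<partial>lborel) /
        (\<integral>\<^sup>+ \<theta>. ennreal (gauss_density \<theta> vx x) * \<pi> \<theta> \<partial>lborel))"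

end

theory Submission imports Defs begin

text \<open>
  The prior is a finite multiple of a proper one: conditionally on \<open>(S, k)\<close> it is the same
  BetaPrime mixture of centred Gaussians, and \<open>b = p / 2 - 2 > 0\<close> makes the mixing density
  integrable.  Since the densities \<open>a\<close>, \<open>c\<close> integrate to one, the loss is the integral of the
  nonnegative Bregman term \<open>a * ln (a / c) - a + c\<close>.  For fixed \<open>x\<close> and \<open>y\<close> the posterior mean
  of this term splits as in Pythagoras' theorem, so the Bayes risk of a rule \<open>q\<close> is that of the
  Bayes rule plus the mean divergence of \<open>q\<close> from it.  The Bayes risk of the Bayes rule is
  finite, by comparison with the plug-in rule \<open>N(x, vy I)\<close>, whose risk is bounded.  Hence a rule
  that is nowhere worse agrees with the Bayes rule almost everywhere and has the same risk.
\<close>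

section \<open>Gaussian densities\<close>

lemma gauss_density_pos: "0 < v \<Longrightarrow> 0 < gauss_density \<mu> v x"
  by (simp add: gauss_density_def)

lemma gauss_density_nonneg [simp]: "0 \<le> gauss_density \<mu> v x"
  by (simp add: gauss_density_def)

lemma gauss_density_le:
  fixes \<mu> x :: "real ^ 'p"
  assumes "0 < v"
  shows "gauss_density \<mu> v x \<le> (2 * pi * v) powr (- (real CARD('p) / 2))"
  using assms by (simp add: gauss_density_def mult_left_le)

lemma borel_measurable_gauss_density [measurable (raw)]:
  fixes f g :: "'a \<Rightarrow> real ^ 'p"
  assumes [measurable]: "f \<in> borel_measurable M" "g \<in> borel_measurable M" "h \<in> borel_measurable M"
  shows "(\<lambda>z. gauss_density (f z) (h z) (g z)) \<in> borel_measurable M"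
  unfolding gauss_density_def by measurable

text \<open>The squared norm is a sum over an orthonormal basis and the normalizing constant is a
  \<open>CARD('p)\<close>-th power, so the total mass reduces to one-dimensional normal
  integrals.\<close>

lemma gauss_density_eq_prod:
  fixes \<mu> x :: "real ^ 'p"
  assumes "0 < v"
  shows "gauss_density \<mu> v x = (\<Prod>b\<in>Basis. normal_density (\<mu> \<bullet> b) (sqrt v) (x \<bullet> b))"
proof -
  have "(\<Prod>b\<in>(Basis :: (real ^ 'p) set). normal_density (\<mu> \<bullet> b) (sqrt v) (x \<bullet> b)) =
      (1 / sqrt (2 * pi * v)) ^ CARD('p) *
      exp (\<Sum>b\<in>Basis. - (x \<bullet> b - \<mu> \<bullet> b)\<^sup>2 / (2 * v))"
    using assms by (simp add: normal_density_def prod_dividef exp_sum power_divide)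
  also have "(\<Sum>b\<in>Basis. - (x \<bullet> b - \<mu> \<bullet> b)\<^sup>2 / (2 * v)) = - (norm (x - \<mu>))\<^sup>2 / (2 * v)"
  proof -
    have "(norm z)\<^sup>2 = (\<Sum>b\<in>Basis. (z \<bullet> b)\<^sup>2)" for z :: "real ^ 'p"
      by (subst power2_norm_eq_inner, subst euclidean_inner) (simp add: power2_eq_square)
    then show ?thesis
      by (simp add: inner_diff_left sum_divide_distrib sum_negf)
  qed
  also have "(1 / sqrt (2 * pi * v)) ^ CARD('p) = (2 * pi * v) powr (- (real CARD('p) / 2))"
  proof -
    have "1 / sqrt (2 * pi * v) = (2 * pi * v) powr (- (1 / 2))"
      using assms by (simp add: powr_minus_divide powr_half_sqrt)
    then have "(1 / sqrt (2 * pi * v)) ^ CARD('p) = ((2 * pi * v) powr (- (1 / 2))) ^ CARD('p)"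
      by simp
    also have "\<dots> = ((2 * pi * v) powr (- (1 / 2))) powr (real CARD('p))"
      using assms by (intro powr_realpow[symmetric]) simp
    finally show ?thesis
      by (simp add: powr_powr)
  qed
  finally show ?thesis
    by (simp add: gauss_density_def)
qed

lemma nn_integral_gauss_density:
  fixes \<mu> :: "real ^ 'p"
  assumes "0 < v"
  shows "(\<integral>\<^sup>+ x. ennreal (gauss_density \<mu> v x) \<partial>lborel) = 1"
proof -
  have "(\<integral>\<^sup>+ x. ennreal (normal_density m (sqrt v) x) \<partial>lborel) = 1" for m
    using assms by (simp add: nn_integral_eq_integral)
  then show ?thesis
    using assms nn_integral_lborel_prod
        [of "\<lambda>b :: real ^ 'p. \<lambda>x. ennreal (normal_density (\<mu> \<bullet> b) (sqrt v) x)" ]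
    by (simp add: gauss_density_eq_prod prod_ennreal)
qed

text \<open>A crude bound, uniform in \<open>\<mu>\<close>, by domination with the Gaussian density
  of variance \<open>2 * v\<close>; it later bounds the risk of the plug-in rule. The exact value is
  \<open>CARD('p) * v\<close>.\<close>

lemma gauss_density_second_moment_bound:
  fixes \<mu> :: "real ^ 'p"
  assumes "0 < v"
  shows "(\<integral>\<^sup>+ x. ennreal (gauss_density \<mu> v x * (norm (x - \<mu>))\<^sup>2) \<partial>lborel)
    \<le> ennreal (4 * v * 2 powr (real CARD('p) / 2))"
proof -
  have *: "gauss_density \<mu> v x * (norm (x - \<mu>))\<^sup>2
      \<le> 4 * v * 2 powr (real CARD('p) / 2) * gauss_density \<mu> (2 * v) x" for x
  proof -
    \<comment> \<open>\<open>t \<le> exp t\<close> trades the factor \<open>t\<close> for a doubled variance.\<close>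
    define t where "t = (norm (x - \<mu>))\<^sup>2 / (4 * v)"
    have "t \<le> exp t"
      using exp_ge_add_one_self[of t] by linarith
    then have "exp (- 2 * t) * t \<le> exp (- 2 * t) * exp t"
      by (intro mult_left_mono) auto
    then have "exp (- 2 * t) * (4 * v * t) \<le> 4 * v * exp (- t)"
      using assms by (simp add: mult_ac flip: exp_add)
    moreover have "4 * v * t = (norm (x - \<mu>))\<^sup>2" "- 2 * t = - (norm (x - \<mu>))\<^sup>2 / (2 * v)"
        "- t = - (norm (x - \<mu>))\<^sup>2 / (2 * (2 * v))"
      using assms by (simp_all add: t_def field_simps)
    ultimately have e: "exp (- (norm (x - \<mu>))\<^sup>2 / (2 * v)) * (norm (x - \<mu>))\<^sup>2
        \<le> 4 * v * exp (- (norm (x - \<mu>))\<^sup>2 / (2 * (2 * v)))"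
      by metis
    \<comment> \<open>Doubling the variance divides the normalizing constant by
      \<open>2 powr (CARD('p) / 2)\<close>; this is the origin of that factor in the bound.\<close>
    have c: "2 powr (real CARD('p) / 2) * (2 * pi * (2 * v)) powr (- (real CARD('p) / 2))
        = (2 * pi * v) powr (- (real CARD('p) / 2))"
    proof -
      have "(2 * pi * (2 * v)) = 2 * (2 * pi * v)"
        by simp
      then have "(2 * pi * (2 * v)) powr (- (real CARD('p) / 2)) =
          2 powr (- (real CARD('p) / 2)) * (2 * pi * v) powr (- (real CARD('p) / 2))"
        using assms by (simp only:) (subst powr_mult, auto)
      then show ?thesis
        by (simp add: powr_minus)
    qed
    have "gauss_density \<mu> v x * (norm (x - \<mu>))\<^sup>2 =
        (2 * pi * v) powr (- (real CARD('p) / 2)) *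
        (exp (- (norm (x - \<mu>))\<^sup>2 / (2 * v)) * (norm (x - \<mu>))\<^sup>2)"
      by (simp add: gauss_density_def)
    also have "\<dots> \<le> (2 * pi * v) powr (- (real CARD('p) / 2)) *
        (4 * v * exp (- (norm (x - \<mu>))\<^sup>2 / (2 * (2 * v))))"
      by (intro mult_left_mono e) auto
    also have "\<dots> = 4 * v * 2 powr (real CARD('p) / 2) * gauss_density \<mu> (2 * v) x"
      unfolding gauss_density_def c[symmetric] by simp
    finally show ?thesis .
  qed
  have "(\<integral>\<^sup>+ x. ennreal (gauss_density \<mu> v x * (norm (x - \<mu>))\<^sup>2) \<partial>lborel) \<le>
      (\<integral>\<^sup>+ x. ennreal (4 * v * 2 powr (real CARD('p) / 2)) *
        ennreal (gauss_density \<mu> (2 * v) x) \<partial>lborel)"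
    using assms by (intro nn_integral_mono) (simp add: * flip: ennreal_mult)
  also have "\<dots> = ennreal (4 * v * 2 powr (real CARD('p) / 2))"
    using assms by (simp add: nn_integral_cmult nn_integral_gauss_density)
  finally show ?thesis .
qed

section \<open>The loss as an integral of nonnegative terms\<close>

text \<open>The Bregman divergence of \<open>t * ln t\<close>. For \<open>a > 0\<close> the value at
  \<open>c = 0\<close> is its limit; for positive \<open>a\<close> and \<open>c\<close> the argument
  of \<open>ennreal\<close> is nonnegative by \<open>ln_ratio_ge\<close>, so truncation loses
  nothing.\<close>

definition kl_integrand :: "real \<Rightarrow> real \<Rightarrow> ennreal" where
  "kl_integrand a c = (if c = 0 then \<infinity> else ennreal (a * ln (a / c) - a + c))"

lemma ln_ratio_ge:
  fixes a c :: real
  assumes "0 < a" "0 < c"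
  shows "a - c \<le> a * ln (a / c)"
proof -
  have "ln (c / a) \<le> c / a - 1"
    using assms ln_le_minus_one[of "c / a"] by simp
  then have "a * ln (c / a) \<le> c - a"
    using assms by (simp add: field_simps)
  then show ?thesis
    using assms by (simp add: ln_div algebra_simps)
qed

text \<open>Truncation at zero yields only an inequality; \<open>ln_ratio_ge\<close> supplies the
  converse, and \<open>ln t = t - 1\<close> forces \<open>t = 1\<close>, here with
  \<open>t = c / a\<close>. This later turns a zero mean divergence into equality of two
  rules.\<close>

lemma kl_integrand_eq_0D:
  assumes "0 < a" "0 \<le> c" "kl_integrand a c = 0"
  shows "c = a"
proof -
  have c: "0 < c" "a * ln (a / c) \<le> a - c"
    using assms by (auto simp: kl_integrand_def ennreal_eq_0_iff split: if_splits)
  then have "a * ln (c / a) = c - a"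
    using ln_ratio_ge[of a c] assms(1) by (simp add: ln_div algebra_simps)
  then have "ln (c / a) = c / a - 1"
    using assms(1) by (simp add: field_simps)
  then show ?thesis
    using ln_eq_minus_one[of "c / a"] c assms(1) by simp
qed

lemma borel_measurable_kl_integrand [measurable (raw)]:
  assumes [measurable]: "f \<in> borel_measurable M" "g \<in> borel_measurable M"
  shows "(\<lambda>z. kl_integrand (f z) (g z)) \<in> borel_measurable M"
  unfolding kl_integrand_def by measurable

text \<open>Equal variances cancel the normalizing constants, so the log ratio is a difference of
  squared distances. The bound splits into pieces whose integrals over \<open>y\<close> are a second
  moment and multiples of unit masses.\<close>

lemma kl_integrand_gauss_density_le:
  fixes \<theta> x y :: "real ^ 'p"
  assumes "0 < v"
  shows "kl_integrand (gauss_density \<theta> v y) (gauss_density x v y) \<le>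
    ennreal (gauss_density \<theta> v y * ((norm (y - \<theta>))\<^sup>2 / v)) +
    ennreal ((norm (x - \<theta>))\<^sup>2 / v) * ennreal (gauss_density \<theta> v y) + ennreal (gauss_density x v y)"
proof -
  let ?a = "gauss_density \<theta> v y"
  have a: "0 < ?a" "0 < gauss_density x v y"
    by (simp_all add: gauss_density_pos assms)
  have "ln (?a / gauss_density x v y) = ((norm (y - x))\<^sup>2 - (norm (y - \<theta>))\<^sup>2) / (2 * v)"
    using a assms by (simp add: ln_div) (simp add: gauss_density_def ln_mult diff_divide_distrib)
  also have "\<dots> \<le> (norm (y - x))\<^sup>2 / (2 * v)"
    using assms by (simp add: divide_right_mono)
  also have "\<dots> \<le> (2 * (norm (y - \<theta>))\<^sup>2 + 2 * (norm (x - \<theta>))\<^sup>2) / (2 * v)"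
  proof (rule divide_right_mono)
    have "norm (y - x) \<le> norm (y - \<theta>) + norm (x - \<theta>)"
      using norm_triangle_ineq4[of "y - \<theta>" "x - \<theta>"] by simp
    then have "(norm (y - x))\<^sup>2 \<le> (norm (y - \<theta>) + norm (x - \<theta>))\<^sup>2"
      by (intro power_mono) auto
    also have "\<dots> \<le> 2 * (norm (y - \<theta>))\<^sup>2 + 2 * (norm (x - \<theta>))\<^sup>2"
      using zero_le_power2[of "norm (y - \<theta>) - norm (x - \<theta>)"]
      by (simp add: power2_sum power2_diff)
    finally show "(norm (y - x))\<^sup>2 \<le> 2 * (norm (y - \<theta>))\<^sup>2 + 2 * (norm (x - \<theta>))\<^sup>2" .
  qed (use assms in simp)
  also have "\<dots> = (norm (y - \<theta>))\<^sup>2 / v + (norm (x - \<theta>))\<^sup>2 / v"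
    using assms by (simp add: add_divide_distrib)
  finally have "?a * ln (?a / gauss_density x v y) \<le>
      ?a * ((norm (y - \<theta>))\<^sup>2 / v + (norm (x - \<theta>))\<^sup>2 / v)"
    using a by (intro mult_left_mono) auto
  then have "?a * ln (?a / gauss_density x v y) - ?a + gauss_density x v y \<le>
      ?a * ((norm (y - \<theta>))\<^sup>2 / v) + (norm (x - \<theta>))\<^sup>2 / v * ?a + gauss_density x v y"
    using a by (simp add: algebra_simps)
  then show ?thesis
    using a assms by (simp add: kl_integrand_def flip: ennreal_mult ennreal_plus)
qed

section \<open>From extended-real integrals to nonnegative ones\<close>

lemma ext_integral_nonneg:
  assumes "\<And>x. 0 \<le> f x"
  shows "ext_integral M f = enn2ereal (\<integral>\<^sup>+ x. e2ennreal (f x) \<partial>M)"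
proof -
  have "e2ennreal (- f x) = 0" for x
    using assms[of x] by (simp add: e2ennreal_neg)
  then show ?thesis by (simp add: ext_integral_def zero_ennreal.rep_eq)
qed

text \<open>Both functions have mass one, so adding \<open>c - a\<close> to the integrand leaves the
  integral unchanged and makes the integrand nonnegative.\<close>

lemma ext_integral_kl:
  assumes [measurable]: "a \<in> borel_measurable M" "c \<in> borel_measurable M"
    and a: "\<And>y. 0 < a y" and c: "\<And>y. 0 \<le> c y"
    and int: "(\<integral>\<^sup>+ y. ennreal (a y) \<partial>M) = 1" "(\<integral>\<^sup>+ y. ennreal (c y) \<partial>M) = 1"
  shows "ext_integral M (\<lambda>y. ereal (a y) * log_ratio (a y) (c y)) =
    enn2ereal (\<integral>\<^sup>+ y. kl_integrand (a y) (c y) \<partial>M)"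
proof -
  define f where "f y = ereal (a y) * log_ratio (a y) (c y)" for y
  have [measurable]: "f \<in> borel_measurable M"
    unfolding f_def log_ratio_def by measurable
  \<comment> \<open>This is \<open>f = kl_integrand a c + a - c\<close> with the negative terms
    moved across, so that it can be integrated in \<open>ennreal\<close>; at \<open>c = 0\<close>
    both sides are infinite.\<close>
  have bal: "e2ennreal (f y) + ennreal (c y)
      = kl_integrand (a y) (c y) + ennreal (a y) + e2ennreal (- f y)" for y
  proof (cases "c y = 0")
    case True
    then show ?thesis
      using a[of y] by (simp add: f_def log_ratio_def kl_integrand_def)
  next
    case False
    then have cy: "0 < c y" using c[of y] by simp
    define r where "r = a y * ln (a y / c y)"
    have "f y = ereal r" and "kl_integrand (a y) (c y) = ennreal (r - a y + c y)"
      using False by (simp_all add: f_def log_ratio_def r_def kl_integrand_def)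
    moreover have "a y - c y \<le> r"
      using ln_ratio_ge[OF a cy] by (simp add: r_def)
    ultimately show ?thesis
      using a[of y] cy
      by (cases "0 \<le> r")
        (simp_all add: e2ennreal_ereal e2ennreal_neg flip: ennreal_plus, simp_all add: ennreal_neg)
  qed
  \<comment> \<open>Since \<open>f \<ge> a - c \<ge> - c\<close>, the negative part has integral at
    most one; being finite, it cancels in the difference that defines
    \<open>ext_integral\<close>.\<close>
  have neg: "e2ennreal (- f y) \<le> ennreal (c y)" for y
  proof (cases "c y = 0")
    case True
    then show ?thesis
      using a[of y] by (simp add: f_def log_ratio_def e2ennreal_neg)
  next
    case False
    then show ?thesis
      using ln_ratio_ge[OF a[of y], of "c y"] c[of y] a[of y]
      by (simp add: f_def log_ratio_def e2ennreal_ereal ennreal_leI)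
  qed
  have le1: "(\<integral>\<^sup>+ y. e2ennreal (- f y) \<partial>M) \<le> 1"
    using nn_integral_mono[of M "\<lambda>y. e2ennreal (- f y)" "\<lambda>y. ennreal (c y)"] neg by (simp add: int)
  have "(\<integral>\<^sup>+ y. e2ennreal (f y) + ennreal (c y) \<partial>M)
      = (\<integral>\<^sup>+ y. kl_integrand (a y) (c y) + ennreal (a y) + e2ennreal (- f y) \<partial>M)"
    by (simp add: bal)
  then have "(\<integral>\<^sup>+ y. e2ennreal (f y) \<partial>M) + 1
      = (\<integral>\<^sup>+ y. kl_integrand (a y) (c y) \<partial>M) + 1 + (\<integral>\<^sup>+ y. e2ennreal (- f y) \<partial>M)"
    by (simp add: nn_integral_add int)
  then have eq: "(\<integral>\<^sup>+ y. e2ennreal (f y) \<partial>M)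
      = (\<integral>\<^sup>+ y. kl_integrand (a y) (c y) \<partial>M) + (\<integral>\<^sup>+ y. e2ennreal (- f y) \<partial>M)"
    by (metis add.assoc add.commute ennreal_add_left_cancel ennreal_one_neq_top infinity_ennreal_def)
  have "ext_integral M f = enn2ereal (\<integral>\<^sup>+ y. kl_integrand (a y) (c y) \<partial>M)"
    unfolding ext_integral_def eq plus_ennreal.rep_eq
    using le1 by (cases "\<integral>\<^sup>+ y. e2ennreal (- f y) \<partial>M")
      (auto simp: ereal_minus_eq_minus_iff ereal_diff_add_inverse add.commute top_unique)
  then show ?thesis
    by (simp add: f_def [abs_def])
qed

section \<open>Pythagorean identity under a finite measure\<close>

lemma (in finite_measure) integral_pos:
  fixes b :: "'a \<Rightarrow> real"
  assumes "integrable M b" "\<And>t. 0 < b t" "0 < measure M (space M)"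
  shows "0 < (\<integral>t. b t \<partial>M)"
proof -
  have "\<not> (AE t in M. b t = 0)"
    using assms(2,3) less_imp_neq[OF assms(2), symmetric]
    by (auto simp: eventually_False ae_filter_eq_bot_iff measure_def)
  then have "(\<integral>t. b t \<partial>M) \<noteq> 0"
    using assms integral_nonneg_eq_0_iff_AE[OF assms(1)] by (simp add: less_imp_le)
  moreover have "0 \<le> (\<integral>t. b t \<partial>M)"
    using assms(2) by (intro integral_nonneg_AE) (simp add: less_imp_le)
  ultimately show ?thesis by simp
qed

text \<open>For \<open>q > 0\<close> the two Bregman terms differ by
  \<open>b t * ln (p / q) - p + q\<close>, which is affine in \<open>b t\<close>. Integration puts
  the mean \<open>p\<close> in place of \<open>b t\<close> and leaves the total mass times
  \<open>kl_integrand p q\<close>.\<close>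

lemma (in finite_measure) nn_integral_kl_integrand_eq:
  fixes q :: real
  assumes b: "integrable M b" "\<And>t. 0 < b t" and q: "0 \<le> q"
    and pos: "0 < measure M (space M)"
  defines "p \<equiv> (\<integral>t. b t \<partial>M) / measure M (space M)"
  shows "(\<integral>\<^sup>+ t. kl_integrand (b t) q \<partial>M) =
    (\<integral>\<^sup>+ t. kl_integrand (b t) p \<partial>M) + ennreal (measure M (space M)) * kl_integrand p q"
proof -
  note [measurable] = borel_measurable_integrable[OF b(1)]
  define m where "m = measure M (space M)"
  have m: "0 < m" "emeasure M (space M) = ennreal m"
    using pos by (simp_all add: m_def emeasure_eq_measure)
  have "0 < (\<integral>t. b t \<partial>M)"
    using b pos by (rule integral_pos)
  then have p: "0 < p" and mp: "(\<integral>t. b t \<partial>M) = m * p"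
    using m by (simp_all add: p_def m_def)
  have int_b: "(\<integral>\<^sup>+ t. ennreal (b t) \<partial>M) = ennreal (m * p)"
    using b by (simp add: nn_integral_eq_integral less_imp_le mp)
  show ?thesis
  proof (cases "q = 0")
    \<comment> \<open>Both sides are infinite, because the total mass is positive.\<close>
    case True
    then show ?thesis
      using m by (simp add: kl_integrand_def ennreal_mult_top ennreal_eq_0_iff m_def)
  next
    case False
    with q have q: "0 < q" by simp
    \<comment> \<open>The positive and negative parts of \<open>ln (p / q)\<close> keep both sides nonnegative, since no
      subtraction is available in \<open>ennreal\<close>.\<close>
    define u where "u = max 0 (ln (p / q))"
    define w where "w = max 0 (- ln (p / q))"
    have uw: "0 \<le> u" "0 \<le> w" "u = ln (p / q) + w"
      by (simp_all add: u_def w_def)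
    have kl: "kl_integrand a c = ennreal (a * ln (a / c) - a + c)" "0 \<le> a * ln (a / c) - a + c"
      if "0 < a" "0 < c" for a c
      using that ln_ratio_ge[of a c] by (simp_all add: kl_integrand_def)
    have "kl_integrand (b t) q + (ennreal w * ennreal (b t) + ennreal p) =
        kl_integrand (b t) p + (ennreal u * ennreal (b t) + ennreal q)" for t
    proof -
      have "b t * ln (b t / q) + w * b t = b t * ln (b t / p) + u * b t"
        using b(2)[of t] p q by (simp add: uw ln_div algebra_simps)
      then show ?thesis
        using kl[OF b(2)[of t]] p q uw(1,2) b(2)[of t]
        by (simp add: less_imp_le flip: ennreal_mult ennreal_plus)
    qed
    then have "(\<integral>\<^sup>+ t. kl_integrand (b t) q + (ennreal w * ennreal (b t) + ennreal p) \<partial>M) =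
        (\<integral>\<^sup>+ t. kl_integrand (b t) p + (ennreal u * ennreal (b t) + ennreal q) \<partial>M)"
      by simp
    then have "(\<integral>\<^sup>+ t. kl_integrand (b t) q \<partial>M) + ennreal (w * (m * p) + p * m) =
        (\<integral>\<^sup>+ t. kl_integrand (b t) p \<partial>M) + ennreal (u * (m * p) + q * m)"
      using p q m uw
      by (simp add: nn_integral_add nn_integral_cmult int_b flip: ennreal_mult)
    also have "ennreal (u * (m * p) + q * m) =
        ennreal m * kl_integrand p q + ennreal (w * (m * p) + p * m)"
      using p q m uw(1,2) kl[OF p q]
      by (simp flip: ennreal_mult ennreal_plus) (simp add: uw(3) algebra_simps)
    \<comment> \<open>The common summand on the left is finite and therefore cancels.\<close>
    finally have "ennreal (w * (m * p) + p * m) + (\<integral>\<^sup>+ t. kl_integrand (b t) q \<partial>M) =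
        ennreal (w * (m * p) + p * m) +
          ((\<integral>\<^sup>+ t. kl_integrand (b t) p \<partial>M) + ennreal m * kl_integrand p q)"
      by (simp only: ac_simps)
    then show ?thesis
      by (simp add: ennreal_add_left_cancel m_def)
  qed
qed

section \<open>Bayes risk for a finite prior\<close>

text \<open>Unnormalized: the total mass is the marginal density of \<open>x\<close>.\<close>

definition posterior :: "real \<Rightarrow> (real ^ 'p \<Rightarrow> ennreal) \<Rightarrow> real ^ 'p \<Rightarrow> (real ^ 'p) measure" where
  "posterior vx \<pi> x = density lborel (\<lambda>\<theta>. ennreal (gauss_density \<theta> vx x) * \<pi> \<theta>)"

text \<open>Built from the Bregman term and not from \<open>KL_risk\<close>, so that Tonelli applies
  directly; \<open>KL_risk_eq\<close> links the two for rules with values in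
  \<open>proper_densities\<close>.\<close>

definition bayes_risk ::
  "real \<Rightarrow> real \<Rightarrow> (real ^ 'p \<Rightarrow> ennreal) \<Rightarrow> (real ^ 'p \<Rightarrow> real ^ 'p \<Rightarrow> real) \<Rightarrow> ennreal" where
  "bayes_risk vx vy \<pi> q =
     (\<integral>\<^sup>+ \<theta>. \<pi> \<theta> * (\<integral>\<^sup>+ x. ennreal (gauss_density \<theta> vx x) *
        (\<integral>\<^sup>+ y. kl_integrand (gauss_density \<theta> vy y) (q x y) \<partial>lborel) \<partial>lborel) \<partial>lborel)"

text \<open>Two uses of Tonelli bring the integral over \<open>\<theta>\<close> innermost, where the
  Pythagorean identity applies at each fixed \<open>x\<close> and \<open>y\<close>.\<close>

lemma bayes_risk_eq_posterior:
  fixes q :: "real ^ 'p \<Rightarrow> real ^ 'p \<Rightarrow> real"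
  assumes [measurable]: "\<pi> \<in> borel_measurable borel"
    "(\<lambda>(x, y). q x y) \<in> borel_measurable (borel \<Otimes>\<^sub>M borel)"
  shows "bayes_risk vx vy \<pi> q =
    (\<integral>\<^sup>+ x. \<integral>\<^sup>+ y. \<integral>\<^sup>+ \<theta>. kl_integrand (gauss_density \<theta> vy y) (q x y)
      \<partial>posterior vx \<pi> x \<partial>lborel \<partial>lborel)"
proof -
  let ?f = "\<lambda>\<theta> x y. ennreal (gauss_density \<theta> vx x) * \<pi> \<theta> *
    kl_integrand (gauss_density \<theta> vy y) (q x y)"
  have "bayes_risk vx vy \<pi> q =
      (\<integral>\<^sup>+ \<theta>. \<integral>\<^sup>+ x. \<integral>\<^sup>+ y. ?f \<theta> x y \<partial>lborel \<partial>lborel \<partial>lborel)"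
    unfolding bayes_risk_def by (simp add: nn_integral_cmult mult_ac flip: nn_integral_cmult)
  also have "\<dots> = (\<integral>\<^sup>+ x. \<integral>\<^sup>+ \<theta>. \<integral>\<^sup>+ y. ?f \<theta> x y \<partial>lborel \<partial>lborel \<partial>lborel)"
    by (intro lborel_pair.Fubini') measurable
  also have "\<dots> = (\<integral>\<^sup>+ x. \<integral>\<^sup>+ y. \<integral>\<^sup>+ \<theta>. ?f \<theta> x y \<partial>lborel \<partial>lborel \<partial>lborel)"
    by (intro nn_integral_cong lborel_pair.Fubini') measurable
  also have "\<dots> = (\<integral>\<^sup>+ x. \<integral>\<^sup>+ y. \<integral>\<^sup>+ \<theta>. kl_integrand (gauss_density \<theta> vy y) (q x y)
      \<partial>posterior vx \<pi> x \<partial>lborel \<partial>lborel)"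
    unfolding posterior_def by (intro nn_integral_cong) (subst nn_integral_density, auto)
  finally show ?thesis .
qed

lemma emeasure_posterior:
  assumes "\<pi> \<in> borel_measurable borel"
  shows "emeasure (posterior vx \<pi> x) (space (posterior vx \<pi> x)) =
    (\<integral>\<^sup>+ \<theta>. ennreal (gauss_density \<theta> vx x) * \<pi> \<theta> \<partial>lborel)"
  using assms by (simp add: posterior_def emeasure_density)

text \<open>What admissibility uses of the prior: measurability and a finite positive mass. The mass
  may differ from one, and the density may be infinite at some points.\<close>

locale finite_prior =
  fixes vx vy :: real and \<pi> :: "real ^ 'p \<Rightarrow> ennreal"
  assumes measurable_prior [measurable]: "\<pi> \<in> borel_measurable borel"
    and prior_finite: "(\<integral>\<^sup>+ \<theta>. \<pi> \<theta> \<partial>lborel) < \<infinity>"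
    and prior_nonzero: "(\<integral>\<^sup>+ \<theta>. \<pi> \<theta> \<partial>lborel) \<noteq> 0"
    and vx: "0 < vx" and vy: "0 < vy"
begin

section \<open>Evidence, posterior mass and the Bayes rule\<close>

lemma evidence_finite: "(\<integral>\<^sup>+ \<theta>. ennreal (gauss_density \<theta> vx x) * \<pi> \<theta> \<partial>lborel) < \<infinity>"
proof -
  have "(\<integral>\<^sup>+ \<theta>. ennreal (gauss_density \<theta> vx x) * \<pi> \<theta> \<partial>lborel)
      \<le> (\<integral>\<^sup>+ \<theta>. ennreal ((2 * pi * vx) powr (- (real CARD('p) / 2))) * \<pi> \<theta> \<partial>lborel)"
    by (intro nn_integral_mono mult_right_mono ennreal_leI gauss_density_le vx) simp
  also have "\<dots> < \<infinity>"
    using prior_finite by (simp add: nn_integral_cmult ennreal_mult_less_top)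
  finally show ?thesis .
qed

text \<open>The likelihood is positive everywhere, so a vanishing evidence would force the prior to
  vanish almost everywhere.\<close>

lemma evidence_nonzero: "(\<integral>\<^sup>+ \<theta>. ennreal (gauss_density \<theta> vx x) * \<pi> \<theta> \<partial>lborel) \<noteq> 0"
proof -
  have "\<not> gauss_density \<theta> vx x \<le> 0" for \<theta>
    using gauss_density_pos[OF vx] by (simp add: not_le)
  then show ?thesis
    using prior_nonzero by (simp add: nn_integral_0_iff_AE ennreal_eq_0_iff)
qed

lemma finite_measure_posterior: "finite_measure (posterior vx \<pi> x)"
  using evidence_finite[of x] by (intro finite_measureI) (simp add: emeasure_posterior)

lemma ennreal_measure_posterior:
  "ennreal (measure (posterior vx \<pi> x) (space (posterior vx \<pi> x))) =
    (\<integral>\<^sup>+ \<theta>. ennreal (gauss_density \<theta> vx x) * \<pi> \<theta> \<partial>lborel)"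
  by (simp add: finite_measure.emeasure_eq_measure[OF finite_measure_posterior, symmetric]
      emeasure_posterior)

lemma measure_posterior_pos: "0 < measure (posterior vx \<pi> x) (space (posterior vx \<pi> x))"
  using evidence_finite[of x] evidence_nonzero[of x]
  by (simp add: measure_def emeasure_posterior enn2real_positive_iff zero_less_iff_neq_zero)

lemma integrable_posterior: "integrable (posterior vx \<pi> x) (\<lambda>\<theta>. gauss_density \<theta> vy y)"
proof -
  interpret finite_measure "posterior vx \<pi> x" by (rule finite_measure_posterior)
  show ?thesis
    using gauss_density_le[OF vy]
    by (intro integrable_const_bound[where B = "(2 * pi * vy) powr (- (real CARD('p) / 2))"])
      (auto simp: posterior_def)
qed

text \<open>Identifies the Bayes rule with the mean \<open>p\<close> of
  \<open>nn_integral_kl_integrand_eq\<close>. The \<open>enn2real\<close> is harmless: both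
  integrals are finite and the evidence is positive.\<close>

lemma bayes_predictive_eq:
  "bayes_predictive vx vy \<pi> x y =
    (\<integral>\<theta>. gauss_density \<theta> vy y \<partial>posterior vx \<pi> x) /
      measure (posterior vx \<pi> x) (space (posterior vx \<pi> x))"
proof -
  interpret finite_measure "posterior vx \<pi> x" by (rule finite_measure_posterior)
  have "(\<integral>\<^sup>+ \<theta>. ennreal (gauss_density \<theta> vx x) * ennreal (gauss_density \<theta> vy y) * \<pi> \<theta> \<partial>lborel)
      = (\<integral>\<^sup>+ \<theta>. ennreal (gauss_density \<theta> vy y) \<partial>posterior vx \<pi> x)"
    by (simp add: posterior_def nn_integral_density mult_ac)
  also have "\<dots> = ennreal (\<integral>\<theta>. gauss_density \<theta> vy y \<partial>posterior vx \<pi> x)"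
    by (intro nn_integral_eq_integral integrable_posterior) simp
  finally show ?thesis
    using measure_posterior_pos[of x]
    by (simp add: bayes_predictive_def emeasure_posterior[symmetric] emeasure_eq_measure
        divide_ennreal integral_nonneg_AE)
qed

lemma bayes_predictive_pos: "0 < bayes_predictive vx vy \<pi> x y"
  unfolding bayes_predictive_eq
  by (intro divide_pos_pos finite_measure.integral_pos finite_measure_posterior
      integrable_posterior measure_posterior_pos gauss_density_pos vy)

lemma measurable_bayes_predictive [measurable]:
  "(\<lambda>(x, y). bayes_predictive vx vy \<pi> x y) \<in> borel_measurable (borel \<Otimes>\<^sub>M borel)"
  unfolding bayes_predictive_def by measurable

text \<open>After multiplication by the evidence \<open>m\<close> no quotient is left under the
  integral; Tonelli integrates \<open>y\<close> out first, with mass one for each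
  \<open>\<theta>\<close>, and \<open>m\<close> cancels.\<close>

lemma nn_integral_bayes_predictive:
  "(\<integral>\<^sup>+ y. ennreal (bayes_predictive vx vy \<pi> x y) \<partial>lborel) = 1"
proof -
  interpret finite_measure "posterior vx \<pi> x" by (rule finite_measure_posterior)
  define m where "m = measure (posterior vx \<pi> x) (space (posterior vx \<pi> x))"
  have m: "0 < m" "(\<integral>\<^sup>+ \<theta>. ennreal (gauss_density \<theta> vx x) * \<pi> \<theta> \<partial>lborel) = ennreal m"
    by (simp_all add: m_def measure_posterior_pos emeasure_posterior[symmetric] emeasure_eq_measure)
  have "ennreal m * (\<integral>\<^sup>+ y. ennreal (bayes_predictive vx vy \<pi> x y) \<partial>lborel) =
      (\<integral>\<^sup>+ y. ennreal m * ennreal (bayes_predictive vx vy \<pi> x y) \<partial>lborel)"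
    by (intro nn_integral_cmult[symmetric]) measurable
  also have "\<dots> = (\<integral>\<^sup>+ y. \<integral>\<^sup>+ \<theta>. ennreal (gauss_density \<theta> vy y) \<partial>posterior vx \<pi> x \<partial>lborel)"
  proof (intro nn_integral_cong)
    fix y
    have "ennreal m * ennreal (bayes_predictive vx vy \<pi> x y) =
        ennreal (\<integral>\<theta>. gauss_density \<theta> vy y \<partial>posterior vx \<pi> x)"
      using m(1) by (simp add: bayes_predictive_eq m_def flip: ennreal_mult)
    then show "ennreal m * ennreal (bayes_predictive vx vy \<pi> x y) =
        (\<integral>\<^sup>+ \<theta>. ennreal (gauss_density \<theta> vy y) \<partial>posterior vx \<pi> x)"
      by (simp add: nn_integral_eq_integral integrable_posterior)
  qed
  also have "\<dots> = (\<integral>\<^sup>+ y. \<integral>\<^sup>+ \<theta>. ennreal (gauss_density \<theta> vx x) * \<pi> \<theta> *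
      ennreal (gauss_density \<theta> vy y) \<partial>lborel \<partial>lborel)"
    unfolding posterior_def by (intro nn_integral_cong) (subst nn_integral_density, auto)
  also have "\<dots> = (\<integral>\<^sup>+ \<theta>. \<integral>\<^sup>+ y. ennreal (gauss_density \<theta> vx x) * \<pi> \<theta> *
      ennreal (gauss_density \<theta> vy y) \<partial>lborel \<partial>lborel)"
    by (intro lborel_pair.Fubini') measurable
  also have "\<dots> = ennreal m"
    using vy by (simp add: nn_integral_cmult nn_integral_gauss_density m(2))
  finally show ?thesis
    using m(1) by (metis ennreal_mult_cancel_left ennreal_neq_top infinity_ennreal_def
        mult.right_neutral ennreal_eq_0_iff not_le)
qed

lemma predictive_rule_bayes_predictive:
  "predictive_rule proper_densities (bayes_predictive vx vy \<pi>)"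
proof -
  have "bayes_predictive vx vy \<pi> x \<in> proper_densities" for x
  proof -
    have [measurable]: "bayes_predictive vx vy \<pi> x \<in> borel_measurable borel"
      unfolding bayes_predictive_def by measurable
    have "has_bochner_integral lborel (bayes_predictive vx vy \<pi> x) 1"
      using bayes_predictive_pos
      by (intro has_bochner_integral_nn_integral) (auto simp: nn_integral_bayes_predictive less_imp_le)
    then show ?thesis
      using bayes_predictive_pos
      by (auto simp: proper_densities_def has_bochner_integral_iff less_imp_le)
  qed
  then show ?thesis
    using measurable_bayes_predictive by (simp add: predictive_rule_def)
qed

lemma bayes_risk_decomposition:
  fixes q :: "real ^ 'p \<Rightarrow> real ^ 'p \<Rightarrow> real"
  assumes [measurable]: "(\<lambda>(x, y). q x y) \<in> borel_measurable (borel \<Otimes>\<^sub>M borel)"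
    and q: "\<And>x y. 0 \<le> q x y"
  shows "bayes_risk vx vy \<pi> q = bayes_risk vx vy \<pi> (bayes_predictive vx vy \<pi>) +
    (\<integral>\<^sup>+ x. \<integral>\<^sup>+ y. ennreal (measure (posterior vx \<pi> x) (space (posterior vx \<pi> x))) *
      kl_integrand (bayes_predictive vx vy \<pi> x y) (q x y) \<partial>lborel \<partial>lborel)"
proof -
  let ?p = "bayes_predictive vx vy \<pi>"
  let ?m = "\<lambda>x. measure (posterior vx \<pi> x) (space (posterior vx \<pi> x))"
  \<comment> \<open>The measure varies with \<open>x\<close>; joint measurability becomes visible
    once the integral is written over the fixed \<open>lborel\<close>.\<close>
  have [measurable]: "(\<lambda>(x, y). \<integral>\<^sup>+ \<theta>. kl_integrand (gauss_density \<theta> vy y) (?p x y)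
      \<partial>posterior vx \<pi> x) \<in> borel_measurable (borel \<Otimes>\<^sub>M borel)"
    unfolding posterior_def by (subst nn_integral_density) measurable
  have "bayes_risk vx vy \<pi> q =
      (\<integral>\<^sup>+ x. \<integral>\<^sup>+ y. (\<integral>\<^sup>+ \<theta>. kl_integrand (gauss_density \<theta> vy y) (?p x y) \<partial>posterior vx \<pi> x) +
        ennreal (?m x) * kl_integrand (?p x y) (q x y) \<partial>lborel \<partial>lborel)"
    unfolding bayes_risk_eq_posterior[OF measurable_prior assms(1)] bayes_predictive_eq
    by (intro nn_integral_cong finite_measure.nn_integral_kl_integrand_eq finite_measure_posterior
        integrable_posterior gauss_density_pos vy q measure_posterior_pos)
  \<comment> \<open>The posterior mass is replaced by the evidence integral, whose measurability in
    \<open>x\<close> is immediate.\<close>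
  also have "\<dots> = (\<integral>\<^sup>+ x. (\<integral>\<^sup>+ y. \<integral>\<^sup>+ \<theta>. kl_integrand (gauss_density \<theta> vy y) (?p x y)
        \<partial>posterior vx \<pi> x \<partial>lborel) +
      (\<integral>\<^sup>+ y. ennreal (?m x) * kl_integrand (?p x y) (q x y) \<partial>lborel) \<partial>lborel)"
    unfolding ennreal_measure_posterior by (intro nn_integral_cong nn_integral_add) measurable
  also have "\<dots> = bayes_risk vx vy \<pi> ?p +
      (\<integral>\<^sup>+ x. \<integral>\<^sup>+ y. ennreal (?m x) * kl_integrand (?p x y) (q x y) \<partial>lborel \<partial>lborel)"
    unfolding ennreal_measure_posterior bayes_risk_eq_posterior[OF measurable_prior measurable_bayes_predictive]
    by (intro nn_integral_add) measurable
  finally show ?thesis .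
qed

text \<open>Finiteness is what permits cancelling this Bayes risk in the admissibility
  argument.\<close>

lemma bayes_risk_bayes_predictive_finite:
  "bayes_risk vx vy \<pi> (bayes_predictive vx vy \<pi>) < \<infinity>"
proof -
  define C where "C = (\<lambda>v. 4 * v * 2 powr (real CARD('p) / 2))"
  have C: "0 \<le> C vx" "0 \<le> C vy"
    using vx vy by (simp_all add: C_def)
  \<comment> \<open>The constant 1 is the mass of the plug-in density, from the last term of
    \<open>kl_integrand_gauss_density_le\<close>.\<close>
  have loss: "(\<integral>\<^sup>+ y. kl_integrand (gauss_density \<theta> vy y) (gauss_density x vy y) \<partial>lborel) \<le>
      ennreal (C vy / vy + 1) + ennreal ((norm (x - \<theta>))\<^sup>2 / vy)" for x \<theta> :: "real ^ 'p"
  proof -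
    have "(\<integral>\<^sup>+ y. ennreal (gauss_density \<theta> vy y * ((norm (y - \<theta>))\<^sup>2 / vy)) \<partial>lborel) =
        (\<integral>\<^sup>+ y. ennreal (1 / vy) * ennreal (gauss_density \<theta> vy y * (norm (y - \<theta>))\<^sup>2) \<partial>lborel)"
      using vy by (simp flip: ennreal_mult)
    also have "\<dots> \<le> ennreal (1 / vy) * ennreal (C vy)"
      using gauss_density_second_moment_bound[OF vy, of \<theta>]
      by (simp add: nn_integral_cmult C_def mult_left_mono)
    also have "\<dots> = ennreal (C vy / vy)"
      using vy C by (simp flip: ennreal_mult)
    finally have mom: "(\<integral>\<^sup>+ y. ennreal (gauss_density \<theta> vy y * ((norm (y - \<theta>))\<^sup>2 / vy)) \<partial>lborel)
      \<le> ennreal (C vy / vy)" .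
    have "(\<integral>\<^sup>+ y. kl_integrand (gauss_density \<theta> vy y) (gauss_density x vy y) \<partial>lborel) \<le>
        (\<integral>\<^sup>+ y. ennreal (gauss_density \<theta> vy y * ((norm (y - \<theta>))\<^sup>2 / vy)) +
          ennreal ((norm (x - \<theta>))\<^sup>2 / vy) * ennreal (gauss_density \<theta> vy y) +
          ennreal (gauss_density x vy y) \<partial>lborel)"
      by (intro nn_integral_mono kl_integrand_gauss_density_le vy)
    also have "\<dots> = (\<integral>\<^sup>+ y. ennreal (gauss_density \<theta> vy y * ((norm (y - \<theta>))\<^sup>2 / vy)) \<partial>lborel) +
        ennreal ((norm (x - \<theta>))\<^sup>2 / vy) + 1"
      using vy by (simp add: nn_integral_add nn_integral_cmult nn_integral_gauss_density)
    also have "\<dots> \<le> ennreal (C vy / vy) + ennreal ((norm (x - \<theta>))\<^sup>2 / vy) + 1"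
      by (intro add_mono mom) auto
    also have "\<dots> = ennreal (C vy / vy + 1) + ennreal ((norm (x - \<theta>))\<^sup>2 / vy)"
      using vy C by (simp add: ennreal_plus ac_simps)
    finally show ?thesis .
  qed
  \<comment> \<open>Averaging over \<open>x\<close> turns the squared distance into the
    second-moment bound \<open>C vx\<close>, so the result is free of
    \<open>\<theta>\<close>.\<close>
  have risk: "(\<integral>\<^sup>+ x. ennreal (gauss_density \<theta> vx x) *
      (\<integral>\<^sup>+ y. kl_integrand (gauss_density \<theta> vy y) (gauss_density x vy y) \<partial>lborel) \<partial>lborel) \<le>
      ennreal (C vy / vy + 1 + C vx / vy)" for \<theta> :: "real ^ 'p"
  proof -
    have "(\<integral>\<^sup>+ x. ennreal (gauss_density \<theta> vx x) *
        (\<integral>\<^sup>+ y. kl_integrand (gauss_density \<theta> vy y) (gauss_density x vy y) \<partial>lborel) \<partial>lborel) \<le>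
        (\<integral>\<^sup>+ x. ennreal (gauss_density \<theta> vx x) *
          (ennreal (C vy / vy + 1) + ennreal ((norm (x - \<theta>))\<^sup>2 / vy)) \<partial>lborel)"
      by (intro nn_integral_mono mult_left_mono loss) simp
    also have "\<dots> = (\<integral>\<^sup>+ x. ennreal (C vy / vy + 1) * ennreal (gauss_density \<theta> vx x) +
          ennreal (1 / vy) * ennreal (gauss_density \<theta> vx x * (norm (x - \<theta>))\<^sup>2) \<partial>lborel)"
      using vx vy C by (intro nn_integral_cong) (simp add: algebra_simps flip: ennreal_mult ennreal_plus)
    also have "\<dots> = ennreal (C vy / vy + 1) +
          ennreal (1 / vy) * (\<integral>\<^sup>+ x. ennreal (gauss_density \<theta> vx x * (norm (x - \<theta>))\<^sup>2) \<partial>lborel)"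
      using vx by (simp add: nn_integral_add nn_integral_cmult nn_integral_gauss_density)
    also have "\<dots> \<le> ennreal (C vy / vy + 1) + ennreal (1 / vy) * ennreal (C vx)"
      using gauss_density_second_moment_bound[OF vx, of \<theta>]
      by (intro add_mono mult_left_mono) (auto simp: C_def)
    also have "\<dots> = ennreal (C vy / vy + 1 + C vx / vy)"
      using vx vy C by (simp flip: ennreal_mult ennreal_plus)
    finally show ?thesis .
  qed
  \<comment> \<open>The decomposition is applied to the plug-in rule and its divergence term is
    dropped.\<close>
  have "bayes_risk vx vy \<pi> (bayes_predictive vx vy \<pi>) \<le> bayes_risk vx vy \<pi> (\<lambda>x. gauss_density x vy)"
    by (subst (2) bayes_risk_decomposition) auto
  also have "\<dots> \<le> (\<integral>\<^sup>+ \<theta>. \<pi> \<theta> * ennreal (C vy / vy + 1 + C vx / vy) \<partial>lborel)"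
    unfolding bayes_risk_def by (intro nn_integral_mono mult_left_mono risk) simp
  also have "\<dots> < \<infinity>"
    using prior_finite by (simp add: nn_integral_multc ennreal_mult_less_top)
  finally show ?thesis .
qed

end

section \<open>Risk and admissibility\<close>

text \<open>\<open>ext_integral_kl\<close> handles the loss; the loss is then nonnegative, so the
  outer integral has no negative part.\<close>

lemma KL_risk_eq:
  fixes q :: "real ^ 'p \<Rightarrow> real ^ 'p \<Rightarrow> real"
  assumes "predictive_rule proper_densities q" "0 < vy"
  shows "KL_risk vx vy \<theta> q = enn2ereal (\<integral>\<^sup>+ x. ennreal (gauss_density \<theta> vx x) *
    (\<integral>\<^sup>+ y. kl_integrand (gauss_density \<theta> vy y) (q x y) \<partial>lborel) \<partial>lborel)"
proof -
  have [measurable]: "(\<lambda>(x, y). q x y) \<in> borel_measurable (borel \<Otimes>\<^sub>M borel)"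
    and q: "q x \<in> proper_densities" for x
    using assms(1) by (auto simp: predictive_rule_def)
  have "KL_loss vy \<theta> (q x) =
      enn2ereal (\<integral>\<^sup>+ y. kl_integrand (gauss_density \<theta> vy y) (q x y) \<partial>lborel)" for x
    unfolding KL_loss_def
    using q[of x] assms(2)
    by (intro ext_integral_kl)
      (auto simp: proper_densities_def gauss_density_pos nn_integral_gauss_density
        nn_integral_eq_integral)
  then have "ereal (gauss_density \<theta> vx x) * KL_loss vy \<theta> (q x) =
      enn2ereal (ennreal (gauss_density \<theta> vx x) *
        (\<integral>\<^sup>+ y. kl_integrand (gauss_density \<theta> vy y) (q x y) \<partial>lborel))" for x
    by (simp add: times_ennreal.rep_eq)
  then show ?thesis
    by (simp add: KL_risk_def ext_integral_nonneg)
qed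

lemma (in finite_prior) KL_admissible_bayes_predictive:
  "KL_admissible vx vy proper_densities (bayes_predictive vx vy \<pi>)"
  unfolding KL_admissible_def
proof (intro conjI notI)
  show "predictive_rule proper_densities (bayes_predictive vx vy \<pi>)"
    by (rule predictive_rule_bayes_predictive)
next
  let ?p = "bayes_predictive vx vy \<pi>"
  let ?m = "\<lambda>x. measure (posterior vx \<pi> x) (space (posterior vx \<pi> x))"
  assume "\<exists>q. predictive_rule proper_densities q \<and>
    (\<forall>\<theta>. KL_risk vx vy \<theta> q \<le> KL_risk vx vy \<theta> ?p) \<and>
    (\<exists>\<theta>. KL_risk vx vy \<theta> q < KL_risk vx vy \<theta> ?p)"
  then obtain q \<theta>' where rule: "predictive_rule proper_densities q"
    and le: "\<And>\<theta>. KL_risk vx vy \<theta> q \<le> KL_risk vx vy \<theta> ?p"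
    and less: "KL_risk vx vy \<theta>' q < KL_risk vx vy \<theta>' ?p"
    by blast
  note risk_eq = KL_risk_eq[OF rule vy] KL_risk_eq[OF predictive_rule_bayes_predictive vy]
  have q_meas [measurable]: "(\<lambda>(x, y). q x y) \<in> borel_measurable (borel \<Otimes>\<^sub>M borel)"
    and q: "0 \<le> q x y" for x y
    using rule by (auto simp: predictive_rule_def proper_densities_def)
  let ?E = "\<integral>\<^sup>+ x. \<integral>\<^sup>+ y. ennreal (?m x) * kl_integrand (?p x y) (q x y) \<partial>lborel \<partial>lborel"
  have "bayes_risk vx vy \<pi> q \<le> bayes_risk vx vy \<pi> ?p"
    unfolding bayes_risk_def
    by (rule nn_integral_mono, rule mult_left_mono)
      (simp_all add: le[unfolded risk_eq, folded less_eq_ennreal.rep_eq])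
  \<comment> \<open>Domination at every \<open>\<theta>\<close>, integrated against the prior,
    leaves no room for the excess \<open>?E\<close>, since the Bayes risk of \<open>?p\<close> is
    finite.\<close>
  then have "bayes_risk vx vy \<pi> ?p + ?E \<le> bayes_risk vx vy \<pi> ?p + 0"
    by (simp add: bayes_risk_decomposition[OF q_meas q])
  then have "?E = 0"
    using bayes_risk_bayes_predictive_finite by (auto simp: ennreal_add_left_cancel_le)
  then have "AE x in lborel. (\<integral>\<^sup>+ y. ennreal (?m x) * kl_integrand (?p x y) (q x y) \<partial>lborel) = 0"
    unfolding ennreal_measure_posterior by (subst (asm) nn_integral_0_iff_AE) measurable
  then have "AE x in lborel. AE y in lborel. q x y = ?p x y"
  proof eventually_elim
    case (elim x)
    then have "AE y in lborel. ennreal (?m x) * kl_integrand (?p x y) (q x y) = 0"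
      by (subst (asm) nn_integral_0_iff_AE) measurable
    then show ?case
    proof eventually_elim
      case (elim y)
      then have "kl_integrand (?p x y) (q x y) = 0"
        using measure_posterior_pos[of x] by (simp add: ennreal_eq_0_iff)
      then show ?case
        by (intro kl_integrand_eq_0D bayes_predictive_pos q)
    qed
  qed
  \<comment> \<open>Equality almost everywhere in \<open>x\<close> and \<open>y\<close> gives equal
    risks at every \<open>\<theta>\<close>, in particular at \<open>\<theta>'\<close>, which may lie
    in a null set of the prior.\<close>
  then have "KL_risk vx vy \<theta>' q = KL_risk vx vy \<theta>' ?p"
    unfolding risk_eq
    by (intro arg_cong[of _ _ enn2ereal] nn_integral_cong_AE)
      (auto elim!: eventually_mono intro!: arg_cong2[of _ _ _ _ "(*)"] nn_integral_cong_AE)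
  with less show False by simp
qed

section \<open>The network prior\<close>

lemma nn_integral_gamma_density:
  assumes "0 < a"
  shows "(\<integral>\<^sup>+ t. ennreal (gamma_density a t) \<partial>lborel) = 1"
proof -
  have "(\<integral>\<^sup>+ t. ennreal (gamma_density a t) \<partial>lborel) =
      (\<integral>\<^sup>+ t. ennreal (1 / Gamma a) * ennreal (indicator {0..} t * t powr (a - 1) / exp t) \<partial>lborel)"
  proof (intro nn_integral_cong)
    fix t
    \<comment> \<open>At \<open>t = 0\<close> both sides vanish, because
      \<open>0 powr _ = 0\<close>.\<close>
    show "ennreal (gamma_density a t) =
        ennreal (1 / Gamma a) * ennreal (indicator {0..} t * t powr (a - 1) / exp t)"
      using Gamma_real_pos[OF assms]
      by (cases "t = 0")
        (auto simp: gamma_density_def indicator_def exp_minus field_simps simp flip: ennreal_mult)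
  qed
  also have "\<dots> = ennreal (1 / Gamma a) * ennreal (Gamma a)"
    by (subst nn_integral_cmult) (auto simp: Gamma_conv_nn_integral_real[OF assms])
  also have "\<dots> = 1"
    using Gamma_real_pos[OF assms] by (simp flip: ennreal_mult)
  finally show ?thesis .
qed

lemma borel_measurable_gamma_density [measurable]: "gamma_density a \<in> borel_measurable borel"
  unfolding gamma_density_def by measurable

text \<open>Since \<open>k l \<ge> 1\<close>, each factor has positive shape and is a probability
  law on the positive half-line. Positivity of \<open>s\<close> matters because the hyperprior is
  constrained only there.\<close>

lemma
  assumes "k \<in> unit_indices d n"
  shows prob_space_S_law: "prob_space (S_law d k)" and AE_S_law_pos: "AE s in S_law d k. 0 < s"
proof -
  let ?G = "\<lambda>l. density lborel (\<lambda>t. ennreal (gamma_density (real (k l) / 2) t))"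
  have G: "prob_space (?G l)" if "l \<in> {1..d - 1}" for l
  proof (rule prob_spaceI)
    have "1 \<le> k l"
      using assms that by (auto simp: unit_indices_def PiE_iff)
    then show "emeasure (?G l) (space (?G l)) = 1"
      by (simp add: emeasure_density nn_integral_gamma_density)
  qed
  have [measurable]: "(\<lambda>t. \<Prod>l\<in>{1..d - 1}. t l) \<in> borel_measurable (Pi\<^sub>M {1..d - 1} ?G)"
    by (intro borel_measurable_prod measurable_compose[OF measurable_component_singleton]) auto
  show "prob_space (S_law d k)"
    unfolding S_law_def by (intro prob_space.prob_space_distr prob_space_PiM G) measurable
  have "AE t in Pi\<^sub>M {1..d - 1} ?G. \<forall>l\<in>{1..d - 1}. 0 < t l"
    by (intro eventually_ball_finite ballI AE_PiM_component G)
      (auto simp: AE_density gamma_density_def)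
  then have "AE t in Pi\<^sub>M {1..d - 1} ?G. 0 < (\<Prod>l\<in>{1..d - 1}. t l)"
    by eventually_elim (auto intro!: prod_pos)
  then show "AE s in S_law d k. 0 < s"
    unfolding S_law_def by (subst AE_distr_iff) auto
qed

section \<open>The BetaPrime law and its Gaussian mixture\<close>

lemma borel_measurable_beta_prime_density [measurable]:
  "beta_prime_density b \<in> borel_measurable borel"
  unfolding beta_prime_density_def by measurable

lemma nn_integral_beta_prime_density:
  assumes "0 < b"
  shows "(\<integral>\<^sup>+ w. ennreal (beta_prime_density b w) \<partial>lborel) = 1"
proof -
  \<comment> \<open>The endpoint 0, a null set, is added to obtain a closed half-line.\<close>
  have "(\<integral>\<^sup>+ w. ennreal (beta_prime_density b w) \<partial>lborel) =
      (\<integral>\<^sup>+ w. ennreal (b * (1 + w) powr (- (b + 1))) * indicator {0..} w \<partial>lborel)"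
    using AE_lborel_singleton[of "0 :: real"]
    by (intro nn_integral_cong_AE) (auto elim!: eventually_mono simp: beta_prime_density_def indicator_def)
  \<comment> \<open>The antiderivative is \<open>- ((1 + w) powr (- b))\<close>, which tends to 0 at
    infinity because \<open>b > 0\<close>.\<close>
  also have "\<dots> = ennreal (0 - (- ((1 + 0) powr (- b))))"
  proof (rule nn_integral_FTC_atLeast)
    fix w :: real
    assume "0 \<le> w"
    then show "((\<lambda>w. - ((1 + w) powr (- b))) has_real_derivative b * (1 + w) powr (- (b + 1))) (at w)"
      by (auto intro!: derivative_eq_intros simp: minus_diff_commute)
  next
    have "((\<lambda>w. - ((1 + w) powr (- b))) \<longlongrightarrow> - 0) at_top"
      using assms
      by (intro tendsto_minus tendsto_neg_powr filterlim_tendsto_add_at_top[OF tendsto_const] filterlim_ident) auto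
    then show "((\<lambda>w. - ((1 + w) powr (- b))) \<longlongrightarrow> 0) at_top"
      by simp
  qed (use assms in auto)
  finally show ?thesis
    by simp
qed

definition beta_prime_mixture :: "real \<Rightarrow> real ^ 'p \<Rightarrow> ennreal" where
  "beta_prime_mixture b \<theta> =
     (\<integral>\<^sup>+ w. ennreal (beta_prime_density b w) * ennreal (gauss_density 0 w \<theta>) \<partial>lborel)"

lemma borel_measurable_beta_prime_mixture [measurable]:
  "beta_prime_mixture b \<in> borel_measurable borel"
  unfolding beta_prime_mixture_def by measurable

lemma nn_integral_beta_prime_mixture:
  assumes "0 < b"
  shows "(\<integral>\<^sup>+ \<theta>. beta_prime_mixture b (\<theta> :: real ^ 'p) \<partial>lborel) = 1"
proof -
  have "(\<integral>\<^sup>+ \<theta>. beta_prime_mixture b (\<theta> :: real ^ 'p) \<partial>lborel) =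
      (\<integral>\<^sup>+ w. \<integral>\<^sup>+ \<theta>. ennreal (beta_prime_density b w) * ennreal (gauss_density 0 w (\<theta> :: real ^ 'p))
        \<partial>lborel \<partial>lborel)"
    unfolding beta_prime_mixture_def
    by (intro lborel_pair.Fubini'[symmetric]) measurable
  also have "\<dots> = (\<integral>\<^sup>+ w. ennreal (beta_prime_density b w) \<partial>lborel)"
  proof (intro nn_integral_cong)
    fix w
    \<comment> \<open>For \<open>w \<le> 0\<close>, where \<open>gauss_density\<close> is not a
      Gaussian density, the BetaPrime factor is zero.\<close>
    show "(\<integral>\<^sup>+ \<theta>. ennreal (beta_prime_density b w) * ennreal (gauss_density 0 w (\<theta> :: real ^ 'p)) \<partial>lborel)
        = ennreal (beta_prime_density b w)"
      by (cases "0 < w")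
        (simp_all add: nn_integral_cmult nn_integral_gauss_density beta_prime_density_def)
  qed
  finally show ?thesis
    using nn_integral_beta_prime_density[OF assms] by simp
qed

text \<open>Given \<open>S\<close> and \<open>k\<close>, the output variance has one and the same
  law, so depth, widths and gamma laws survive only through the total weight.\<close>

lemma bnn_prior_eq:
  fixes \<theta> :: "real ^ 'p"
  assumes "beta_prime_hyperprior d n x0 b H"
  shows "bnn_prior d n x0 H \<theta> =
    (\<Sum>k\<in>unit_indices d n. ennreal (unit_weight d n k)) * beta_prime_mixture b \<theta>"
proof -
  have cond: "(\<integral>\<^sup>+ \<sigma>. ennreal (gauss_density 0 (scale_factor d x0 \<sigma> * s) \<theta>) \<partial>H k s) =
      beta_prime_mixture b \<theta>" if k: "k \<in> unit_indices d n" and s: "0 < s" for k s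
  proof -
    have sets: "sets (H k s) = sets (\<Pi>\<^sub>M l\<in>{1..d}. (borel :: real measure))"
      and distr: "distr (H k s) borel (\<lambda>\<sigma>. scale_factor d x0 \<sigma> * s) =
        density lborel (\<lambda>w. ennreal (beta_prime_density b w))"
      using assms k s by (auto simp: beta_prime_hyperprior_def)
    have [measurable]: "(\<lambda>\<sigma>. scale_factor d x0 \<sigma> * s) \<in> borel_measurable (H k s)"
      unfolding measurable_cong_sets[OF sets refl] scale_factor_def by measurable
    have "(\<integral>\<^sup>+ \<sigma>. ennreal (gauss_density 0 (scale_factor d x0 \<sigma> * s) \<theta>) \<partial>H k s) =
        (\<integral>\<^sup>+ w. ennreal (gauss_density 0 w \<theta>) \<partial>distr (H k s) borel (\<lambda>\<sigma>. scale_factor d x0 \<sigma> * s))"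
      by (subst nn_integral_distr) auto
    also have "\<dots> = beta_prime_mixture b \<theta>"
      unfolding distr beta_prime_mixture_def by (subst nn_integral_density) auto
    finally show ?thesis .
  qed
  have "(\<integral>\<^sup>+ s. (\<integral>\<^sup>+ \<sigma>. ennreal (gauss_density 0 (scale_factor d x0 \<sigma> * s) \<theta>) \<partial>H k s) \<partial>S_law d k) =
      beta_prime_mixture b \<theta>" if k: "k \<in> unit_indices d n" for k
  proof -
    \<comment> \<open>The inner integral is almost surely constant in \<open>s\<close>, and
      \<open>S_law d k\<close> has mass one.\<close>
    have "(\<integral>\<^sup>+ s. (\<integral>\<^sup>+ \<sigma>. ennreal (gauss_density 0 (scale_factor d x0 \<sigma> * s) \<theta>) \<partial>H k s) \<partial>S_law d k) =
        (\<integral>\<^sup>+ s. beta_prime_mixture b \<theta> \<partial>S_law d k)"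
      using AE_S_law_pos[OF k] by (intro nn_integral_cong_AE) (auto elim!: eventually_mono simp: cond k)
    then show ?thesis
      using prob_space.emeasure_space_1[OF prob_space_S_law[OF k]] by simp
  qed
  then show ?thesis
    by (simp add: bnn_prior_def sum_distrib_right)
qed

lemma finite_unit_indices: "finite (unit_indices d n)"
  unfolding unit_indices_def by (intro finite_PiE) auto

lemma sum_unit_weight_nonzero:
  assumes "\<And>l. l \<in> {1..d - 1} \<Longrightarrow> n l \<ge> 1"
  shows "(\<Sum>k\<in>unit_indices d n. ennreal (unit_weight d n k)) \<noteq> 0"
proof -
  \<comment> \<open>One active unit per layer: the binomials become \<open>n l \<ge> 1\<close>. The
    restricted abstraction makes \<open>k\<close> extensional, as membership in the product set
    demands.\<close>
  define k where "k = (\<lambda>l\<in>{1..d - 1}. 1 :: nat)"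
  have "k \<in> unit_indices d n"
    using assms by (auto simp: k_def unit_indices_def)
  moreover have "0 < unit_weight d n k"
    unfolding unit_weight_def k_def using assms
    by (intro divide_pos_pos prod_pos) (auto simp: Suc_le_eq)
  ultimately show ?thesis
    using finite_unit_indices[of d n] by (auto simp: ennreal_eq_0_iff not_le)
qed

theorem corollary4p2:
  fixes d :: nat
    and n :: "nat \<Rightarrow> nat"
    and vx vy :: real
    and x0 :: "real ^ 'm"
    and H :: "(nat \<Rightarrow> nat) \<Rightarrow> real \<Rightarrow> (nat \<Rightarrow> real) measure"
    and \<pi> :: "real ^ 'p \<Rightarrow> ennreal"
  assumes "CARD('p) \<ge> 5"
    and "d \<ge> 2"
    and "\<And>l. l \<in> {1..d - 1} \<Longrightarrow> n l \<ge> 1"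
    and "vx > 0" and "vy > 0"
    and "beta_prime_hyperprior d n x0 (real CARD('p) / 2 - 2) H"
    and "\<pi> = bnn_prior d n x0 H"
  shows "KL_admissible vx vy proper_densities (bayes_predictive vx vy \<pi>)"
proof -
  define b where "b = real CARD('p) / 2 - 2"
  define c where "c = (\<Sum>k\<in>unit_indices d n. ennreal (unit_weight d n k))"
  \<comment> \<open>Dimension at least 5 gives \<open>b \<ge> 1 / 2\<close>, so the BetaPrime
    density has mass one.\<close>
  have b: "0 < b"
    using assms(1) by (simp add: b_def)
  have c: "c \<noteq> 0" "c < \<infinity>"
    using sum_unit_weight_nonzero[of d n] assms(3) finite_unit_indices[of d n]
    by (auto simp: c_def simp flip: less_top)
  have \<pi>: "\<pi> = (\<lambda>\<theta>. c * beta_prime_mixture b \<theta>)"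
    using assms(6,7) by (simp add: fun_eq_iff bnn_prior_eq c_def b_def)
  \<comment> \<open>The mixture has mass one, so the prior mass is exactly \<open>c\<close>, finite
    and nonzero as \<open>finite_prior\<close> requires.\<close>
  have "(\<integral>\<^sup>+ \<theta>. \<pi> \<theta> \<partial>lborel) = c"
    using b by (simp add: \<pi> nn_integral_cmult nn_integral_beta_prime_mixture)
  moreover have "\<pi> \<in> borel_measurable borel"
    unfolding \<pi> by measurable
  ultimately interpret finite_prior vx vy \<pi>
    using assms(4,5) c by unfold_locales auto
  show ?thesis
    by (rule KL_admissible_bayes_predictive)
qed

end
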